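(* The dcpo $H$ does not belong to $\mathcal R_2$. Consequently, $\mathcal R_2\subsetneq\mathbf{DCPO}$.
   Context: Directed subsets are nonempty; a dcpo is a poset in which every directed subset has a supremum. $\mathbf{DCPO}$ is the category of dcpos and Scott-continuous maps. For dcpos $A,B$, $[A\to B]$ is the dcpo of Scott-continuous maps ordered pointwise. All full subcategories are closed under isomorphisms. Let $2=\{0<1\}$. $E_2$ is the class of all Scott-continuous maps $e:A\to B$ between dcpos such that $e^*:[B\to 2]\to[A\to 2]$, $g\mapsto g\circ e$, is an isomorphism of dcpos (equivalently, $e^{-1}$ is an order isomorphism from the lattice of Scott-open sets of $B$ onto that of $A$). $\mathcal R_2=E_2^{\perp}$ is the full subcategory of $\mathbf{DCPO}$ of all dcpos $C$ such that for every $e:A\to B$ in $E_2$ the map $e^*:[B\to C]\to[A\to C]$, $g\mapsto g\circ e$, is an isomorphism of dcpos. The dcpo $H$ (of Ho, Goubault-Larrecq, Jung and Xi): let $\mathbb N=\{1,2,\ldots\}$ and let $\mathbb N^*$ be the set of finite strings of natural numbers, with empty string $\varepsilon$; $n.s$ is the string obtained by adjoining $n$ to the front of $s$, $ts$ is the concatenation of $t$ and $s$, and $\min(t)$ is the smallest entry of a nonempty string $t$. The underlying set of $H$ is $\mathbb N\times\mathbb N^*$. Define relations, for $m,m',n,n'\in\mathbb N$ and $s,t\in\mathbb N^*$: - $(m,n.s)<_1(m,n'.s)$ if $n<n'$; - $(m,ts)<_2(m,s)$ if $t\ne\varepsilon$; - $(m,ts)<_3(m',s)$ if $t\neq\varepsilon$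 and $\min(t)\le m'$. Writing $R;S$ for the composite relation (first $R$, then $S$), put ${<}={<_1}\cup{<_2}\cup{<_3}\cup({<_2};{<_1})\cup({<_3};{<_1})$ and let $\le$ be the union of $<$ and equality. It is known that $\le$ is a partial order and that $H=(\mathbb N\times\mathbb N^*,\le)$ is a dcpo. *)

theory Defs
  imports "HOL-Algebra.Order" "HOL-Library.FuncSet"
begin

section \<open>Dcpos and Scott-continuous maps\<close>

definition directed :: "'a gorder \<Rightarrow> 'a set \<Rightarrow> bool" where
  "directed L D \<longleftrightarrow> D \<subseteq> carrier L \<and> D \<noteq> {} \<and>
     (\<forall>x\<in>D. \<forall>y\<in>D. \<exists>z\<in>D. x \<sqsubseteq>\<^bsub>L\<^esub> z \<and> y \<sqsubseteq>\<^bsub>L\<^esub> z)"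

definition DCPO :: "'a gorder set" where
  "DCPO = {L. partial_order L \<and> (\<forall>D. directed L D \<longrightarrow> (\<exists>s. is_lub L s D))}"

text \<open>Morphisms are represented extensionally (value \<open>undefined\<close> outside the carrier of the
  domain), so that equality in HOL is equality of maps between the carriers.\<close>

definition scott_maps :: "'a gorder \<Rightarrow> 'b gorder \<Rightarrow> ('a \<Rightarrow> 'b) set" where
  "scott_maps A B = {f \<in> carrier A \<rightarrow>\<^sub>E carrier B. isotone A B f \<and>
     (\<forall>D s. directed A D \<longrightarrow> is_lub A s D \<longrightarrow> is_lub B (f s) (f ` D))}"

definition fun_dcpo :: "'a gorder \<Rightarrow> 'b gorder \<Rightarrow> ('a \<Rightarrow> 'b) gorder" where
  "fun_dcpo A B = \<lparr>carrier = scott_maps A B, eq = (=),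
     le = (\<lambda>f g. \<forall>x\<in>carrier A. f x \<sqsubseteq>\<^bsub>B\<^esub> g x)\<rparr>"

text \<open>Isomorphisms in the category of dcpos: Scott-continuous maps with a Scott-continuous
  inverse.\<close>

definition dcpo_iso :: "'a gorder \<Rightarrow> 'b gorder \<Rightarrow> ('a \<Rightarrow> 'b) \<Rightarrow> bool" where
  "dcpo_iso A B f \<longleftrightarrow> f \<in> scott_maps A B \<and>
     (\<exists>g\<in>scott_maps B A. (\<forall>x\<in>carrier A. g (f x) = x) \<and> (\<forall>y\<in>carrier B. f (g y) = y))"

text \<open>\<open>precomp A B C e\<close> is the map \<open>e\<^sup>* : [B \<rightarrow> C] \<rightarrow> [A \<rightarrow> C]\<close>, \<open>g \<mapsto> g \<circ> e\<close>.\<close>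

definition precomp ::
  "'a gorder \<Rightarrow> 'b gorder \<Rightarrow> 'c gorder \<Rightarrow> ('a \<Rightarrow> 'b) \<Rightarrow> ('b \<Rightarrow> 'c) \<Rightarrow> ('a \<Rightarrow> 'c)" where
  "precomp A B C e = (\<lambda>g\<in>scott_maps B C. compose (carrier A) g e)"

section \<open>The class \<open>E\<^sub>2\<close> and the subcategory \<open>R\<^sub>2\<close>\<close>

text \<open>The two-element chain, with \<open>False < True\<close>.\<close>

definition two :: "bool gorder" where
  "two = \<lparr>carrier = UNIV, eq = (=), le = (\<le>)\<rparr>"

text \<open>The type \<open>'u\<close> is the universe in which the carriers of the test dcpos live; HOL does not
  allow quantification over all types inside a formula.\<close>

definition E2 :: "('u gorder \<times> 'u gorder \<times> ('u \<Rightarrow> 'u)) set" where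
  "E2 = {(A, B, e). A \<in> DCPO \<and> B \<in> DCPO \<and> e \<in> scott_maps A B \<and>
     dcpo_iso (fun_dcpo B two) (fun_dcpo A two) (precomp A B two e)}"

definition orth :: "('u gorder \<times> 'u gorder \<times> ('u \<Rightarrow> 'u)) set \<Rightarrow> 'c gorder set" where
  "orth E = {C \<in> DCPO. \<forall>(A, B, e)\<in>E.
     dcpo_iso (fun_dcpo B C) (fun_dcpo A C) (precomp A B C e)}"

definition R2 :: "'u itself \<Rightarrow> 'c gorder set" where
  "R2 _ = orth (E2 :: ('u gorder \<times> 'u gorder \<times> ('u \<Rightarrow> 'u)) set)"

section \<open>The dcpo \<open>H\<close>\<close>

definition Npos :: "nat set" where
  "Npos = {1..}"

definition H_carrier :: "(nat \<times> nat list) set" where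
  "H_carrier = Npos \<times> lists Npos"

definition lt1 :: "(nat \<times> nat list) rel" where
  "lt1 = {((m, n # s), (m, n' # s)) | m n n' s.
     m \<in> Npos \<and> n \<in> Npos \<and> n' \<in> Npos \<and> s \<in> lists Npos \<and> n < n'}"

definition lt2 :: "(nat \<times> nat list) rel" where
  "lt2 = {((m, t @ s), (m, s)) | m t s.
     m \<in> Npos \<and> t \<in> lists Npos \<and> s \<in> lists Npos \<and> t \<noteq> []}"

definition lt3 :: "(nat \<times> nat list) rel" where
  "lt3 = {((m, t @ s), (m', s)) | m m' t s.
     m \<in> Npos \<and> m' \<in> Npos \<and> t \<in> lists Npos \<and> s \<in> lists Npos \<and> t \<noteq> [] \<and> Min (set t) \<le> m'}"

text \<open>\<open>R O S\<close> relates \<open>x\<close> to \<open>z\<close> iff \<open>(x, y) \<in> R\<close> and \<open>(y, z) \<in> S\<close> for some \<open>y\<close>.\<close>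

definition H_less :: "(nat \<times> nat list) rel" where
  "H_less = lt1 \<union> lt2 \<union> lt3 \<union> (lt2 O lt1) \<union> (lt3 O lt1)"

definition H :: "(nat \<times> nat list) gorder" where
  "H = \<lparr>carrier = H_carrier, eq = (=), le = (\<lambda>x y. (x, y) \<in> H_less \<or> x = y)\<rparr>"

end

theory Submission
  imports Defs "HOL-Library.Countable" "HOL-Library.Infinite_Set"
begin

text \<open>Every level \<open>{(m, s) | m}\<close> of \<open>H\<close> is an irreducible set without a supremum in \<open>H\<close>.
  Adding to \<open>H\<close> a supremum \<open>\<top>\<^sub>s\<close> of each level gives a dcpo \<open>H_hat\<close> in which \<open>\<top>\<^sub>s\<close> is the supremum of
  the chain of all \<open>\<top>\<^bsub>n.s\<^esub>\<close>.  Since \<open>\<top>\<^bsub>n.s\<^esub>\<close> lies below \<open>(n, s)\<close>, every Scott open set containing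
  \<open>\<top>\<^sub>s\<close> meets level \<open>s\<close>, so the inclusion \<open>H \<rightarrow> H_hat\<close> belongs to \<open>E\<^sub>2\<close>.  The identity of \<open>H\<close> does
  not extend along it, because the maximal elements \<open>(m, \<epsilon>)\<close> have no common upper bound in \<open>H\<close>.\<close>

section \<open>Scott-continuous maps and order isomorphisms\<close>

lemma partial_orderI:
  assumes "eq L = (=)"
    and "\<And>x. x \<in> carrier L \<Longrightarrow> x \<sqsubseteq>\<^bsub>L\<^esub> x"
    and "\<And>x y. x \<sqsubseteq>\<^bsub>L\<^esub> y \<Longrightarrow> y \<sqsubseteq>\<^bsub>L\<^esub> x \<Longrightarrow> x \<in> carrier L \<Longrightarrow> y \<in> carrier L \<Longrightarrow> x = y"
    and "\<And>x y z. x \<sqsubseteq>\<^bsub>L\<^esub> y \<Longrightarrow> y \<sqsubseteq>\<^bsub>L\<^esub> z \<Longrightarrow> x \<in> carrier L \<Longrightarrow> y \<in> carrier L \<Longrightarrow> z \<in> carrier L \<Longrightarrow> x \<sqsubseteq>\<^bsub>L\<^esub> z"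
  shows "partial_order L"
proof
  show "x \<sqsubseteq>\<^bsub>L\<^esub> z" if "x \<sqsubseteq>\<^bsub>L\<^esub> y" "y \<sqsubseteq>\<^bsub>L\<^esub> z" "x \<in> carrier L" "y \<in> carrier L" "z \<in> carrier L" for x y z
    using assms(4) that by blast
qed (use assms(1-3) in auto)

lemma is_lub_iff:
  assumes "D \<subseteq> carrier L"
  shows "is_lub L s D \<longleftrightarrow> s \<in> carrier L \<and> (\<forall>d\<in>D. d \<sqsubseteq>\<^bsub>L\<^esub> s) \<and>
    (\<forall>u\<in>carrier L. (\<forall>d\<in>D. d \<sqsubseteq>\<^bsub>L\<^esub> u) \<longrightarrow> s \<sqsubseteq>\<^bsub>L\<^esub> u)"
  using assms unfolding least_def Upper_def by blast

lemma is_lub_unique: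
  assumes "partial_order L" "is_lub L s D" "is_lub L s' D"
  shows "s = s'"
  using assms by (metis partial_order.eq_is_equal partial_order.axioms(1)
      weak_partial_order.weak_least_unique)

lemma directed_image:
  assumes "directed A D" "isotone A B f" "f ` carrier A \<subseteq> carrier B"
  shows "directed B (f ` D)"
proof -
  have D: "D \<subseteq> carrier A" "D \<noteq> {}" using assms(1) by (auto simp: directed_def)
  have mono: "f x \<sqsubseteq>\<^bsub>B\<^esub> f y" if "x \<sqsubseteq>\<^bsub>A\<^esub> y" "x \<in> D" "y \<in> D" for x y
    using assms(2) that subsetD[OF D(1)] by (simp add: isotone_def)
  have "\<exists>z\<in>D. f x \<sqsubseteq>\<^bsub>B\<^esub> f z \<and> f y \<sqsubseteq>\<^bsub>B\<^esub> f z" if "x \<in> D" "y \<in> D" for x y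
  proof -
    obtain z where "z \<in> D" "x \<sqsubseteq>\<^bsub>A\<^esub> z" "y \<sqsubseteq>\<^bsub>A\<^esub> z"
      using assms(1) \<open>x \<in> D\<close> \<open>y \<in> D\<close> unfolding directed_def by blast
    then show ?thesis using mono that by blast
  qed
  moreover have "f ` D \<subseteq> carrier B" using D(1) assms(3) by blast
  ultimately show ?thesis using D(2) by (auto simp: directed_def)
qed

lemma scott_maps_cong:
  assumes "f \<in> scott_maps A B" "\<And>x. x \<in> carrier A \<Longrightarrow> g x = f x" "g \<in> extensional (carrier A)"
  shows "g \<in> scott_maps A B"
proof -
  have "g = f"
    using assms by (intro extensionalityI[of _ "carrier A"]) (auto simp: scott_maps_def PiE_def)
  then show ?thesis using assms by simp
qed

lemma scott_maps_compose:
  assumes f: "f \<in> scott_maps A B" and g: "g \<in> scott_maps B C"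
  shows "compose (carrier A) g f \<in> scott_maps A C"
proof -
  have fc: "f x \<in> carrier B" if "x \<in> carrier A" for x
    using f that by (auto simp: scott_maps_def)
  have gc: "g x \<in> carrier C" if "x \<in> carrier B" for x
    using g that by (auto simp: scott_maps_def)
  have "is_lub C (g (f s)) (g ` f ` D)" if "directed A D" "is_lub A s D" for D s
  proof -
    have "is_lub B (f s) (f ` D)" using f that by (auto simp: scott_maps_def)
    moreover have "directed B (f ` D)"
      using f fc that(1) by (intro directed_image) (auto simp: scott_maps_def)
    ultimately show ?thesis using g by (auto simp: scott_maps_def)
  qed
  moreover have "compose (carrier A) g f ` D = g ` f ` D" if "D \<subseteq> carrier A" for D
    using that by (force simp: compose_def)
  ultimately show ?thesis
    using f g fc gc
    by (auto simp: scott_maps_def isotone_def compose_def directed_def least_def)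
qed

section \<open>Order isomorphisms of posets\<close>

definition order_iso :: "'a gorder \<Rightarrow> 'b gorder \<Rightarrow> ('a \<Rightarrow> 'b) \<Rightarrow> bool" where
  "order_iso A B f \<longleftrightarrow> partial_order A \<and> partial_order B \<and> f ` carrier A = carrier B \<and>
     (\<forall>x\<in>carrier A. \<forall>y\<in>carrier A. f x \<sqsubseteq>\<^bsub>B\<^esub> f y \<longleftrightarrow> x \<sqsubseteq>\<^bsub>A\<^esub> y)"

lemma order_isoD:
  assumes "order_iso A B f"
  shows "partial_order A" "partial_order B" "f ` carrier A = carrier B"
    and "\<And>x y. x \<in> carrier A \<Longrightarrow> y \<in> carrier A \<Longrightarrow> f x \<sqsubseteq>\<^bsub>B\<^esub> f y \<longleftrightarrow> x \<sqsubseteq>\<^bsub>A\<^esub> y"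
    and "\<And>x. x \<in> carrier A \<Longrightarrow> f x \<in> carrier B"
proof -
  note * = assms[unfolded order_iso_def]
  show "partial_order A" "partial_order B" "f ` carrier A = carrier B"
    and "\<And>x y. x \<in> carrier A \<Longrightarrow> y \<in> carrier A \<Longrightarrow> f x \<sqsubseteq>\<^bsub>B\<^esub> f y \<longleftrightarrow> x \<sqsubseteq>\<^bsub>A\<^esub> y"
    using * by blast+
  then show "\<And>x. x \<in> carrier A \<Longrightarrow> f x \<in> carrier B" by blast
qed

lemma order_iso_isotone:
  assumes "order_iso A B f"
  shows "isotone A B f"
  using order_isoD[OF assms] by (simp add: partial_order_def isotone_def)

lemma order_iso_inj_on:
  assumes "order_iso A B f"
  shows "inj_on f (carrier A)"
proof (rule inj_onI)
  fix x y assume xy: "x \<in> carrier A" "y \<in> carrier A" "f x = f y"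
  interpret A: partial_order A using assms by (simp add: order_iso_def)
  interpret B: partial_order B using assms by (simp add: order_iso_def)
  have "f x \<in> carrier B" using assms xy by (auto simp: order_iso_def)
  then have "f x \<sqsubseteq>\<^bsub>B\<^esub> f y" "f y \<sqsubseteq>\<^bsub>B\<^esub> f x" using xy by auto
  then have "x \<sqsubseteq>\<^bsub>A\<^esub> y" "y \<sqsubseteq>\<^bsub>A\<^esub> x" using assms xy(1,2) unfolding order_iso_def by blast+
  then show "x = y" using xy A.eq_is_equal A.weak_le_antisym by auto
qed

lemma order_iso_inv:
  assumes "order_iso A B f"
  shows "order_iso B A (inv_into (carrier A) f)"
  unfolding order_iso_def
proof (intro conjI ballI)
  show "inv_into (carrier A) f ` carrier B = carrier A"
    using assms order_iso_inj_on[OF assms] inj_on_imp_bij_betw bij_betw_imp_surj_on bij_betw_inv_into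
    unfolding order_iso_def by metis
next
  fix x y assume xy: "x \<in> carrier B" "y \<in> carrier B"
  then have "x = f (inv_into (carrier A) f x)" "y = f (inv_into (carrier A) f y)"
    "inv_into (carrier A) f x \<in> carrier A" "inv_into (carrier A) f y \<in> carrier A"
    using assms by (auto simp: order_iso_def f_inv_into_f inv_into_into)
  then show "inv_into (carrier A) f x \<sqsubseteq>\<^bsub>A\<^esub> inv_into (carrier A) f y \<longleftrightarrow> x \<sqsubseteq>\<^bsub>B\<^esub> y"
    using assms unfolding order_iso_def by metis
qed (use assms in \<open>auto simp: order_iso_def\<close>)

lemma order_iso_is_lub:
  assumes iso: "order_iso A B f" and D: "D \<subseteq> carrier A" and lub: "is_lub A s D"
  shows "is_lub B (f s) (f ` D)"
proof -
  note iso = order_isoD[OF iso]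
  have s: "s \<in> carrier A" "\<And>d. d \<in> D \<Longrightarrow> d \<sqsubseteq>\<^bsub>A\<^esub> s"
    "\<And>u. u \<in> carrier A \<Longrightarrow> \<forall>d\<in>D. d \<sqsubseteq>\<^bsub>A\<^esub> u \<Longrightarrow> s \<sqsubseteq>\<^bsub>A\<^esub> u"
    using lub by (simp_all add: is_lub_iff[OF D])
  have fD: "f ` D \<subseteq> carrier B" using iso(5) D by blast
  have "f s \<sqsubseteq>\<^bsub>B\<^esub> u" if u: "u \<in> carrier B" "\<forall>d\<in>D. f d \<sqsubseteq>\<^bsub>B\<^esub> u" for u
  proof -
    obtain v where v: "u = f v" "v \<in> carrier A" using u(1) iso(3) by (metis imageE)
    have "\<forall>d\<in>D. d \<sqsubseteq>\<^bsub>A\<^esub> v" using u(2) v iso(4) D by (metis subsetD)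
    then show ?thesis using s v iso(4) by simp
  qed
  moreover have "\<forall>d\<in>D. f d \<sqsubseteq>\<^bsub>B\<^esub> f s" using s iso(4) D by (metis subsetD)
  ultimately show ?thesis
    using iso(5)[OF s(1)] by (simp add: is_lub_iff[OF fD])
qed

lemma order_iso_scott_map:
  assumes "order_iso A B f"
  shows "restrict f (carrier A) \<in> scott_maps A B"
proof -
  have "is_lub B (restrict f (carrier A) s) (restrict f (carrier A) ` D)"
    if "directed A D" "is_lub A s D" for D s
  proof -
    have D: "D \<subseteq> carrier A" using that(1) by (simp add: directed_def)
    then have "restrict f (carrier A) ` D = f ` D" by force
    moreover have "s \<in> carrier A" using that(2) by (rule least_closed)
    ultimately show ?thesis using order_iso_is_lub[OF assms D that(2)] by simp
  qed
  moreover have "isotone A B (restrict f (carrier A))"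
    using order_iso_isotone[OF assms] by (simp add: isotone_def)
  moreover have "restrict f (carrier A) \<in> carrier A \<rightarrow>\<^sub>E carrier B"
    using order_isoD(5)[OF assms] by simp
  ultimately show ?thesis by (simp add: scott_maps_def)
qed

text \<open>A surjection that preserves and reflects the order is injective by antisymmetry, and
  both it and its inverse preserve every existing supremum. Scott continuity is automatic, so an
  isomorphism of dcpos can be checked on the order alone.\<close>

lemma order_iso_dcpo_iso:
  assumes iso: "order_iso A B f" and "f \<in> extensional (carrier A)"
  shows "dcpo_iso A B f"
  unfolding dcpo_iso_def
proof (intro conjI bexI[of _ "restrict (inv_into (carrier A) f) (carrier B)"])
  show "f \<in> scott_maps A B"
    using order_iso_scott_map[OF iso] assms(2) by (simp add: extensional_restrict)
  show "restrict (inv_into (carrier A) f) (carrier B) \<in> scott_maps B A"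
    by (rule order_iso_scott_map[OF order_iso_inv[OF iso]])
  show "\<forall>x\<in>carrier A. restrict (inv_into (carrier A) f) (carrier B) (f x) = x"
    using order_isoD(5)[OF iso] order_iso_inj_on[OF iso] by simp
  show "\<forall>y\<in>carrier B. f (restrict (inv_into (carrier A) f) (carrier B) y) = y"
    using order_isoD(3)[OF iso] by (simp add: f_inv_into_f)
qed

lemma order_iso_DCPO:
  assumes iso: "order_iso A B f" and "A \<in> DCPO"
  shows "B \<in> DCPO"
proof -
  let ?g = "inv_into (carrier A) f"
  have "\<exists>s. is_lub B s D" if D: "directed B D" for D
  proof -
    have Dc: "D \<subseteq> f ` carrier A"
      using D order_isoD(3)[OF iso] by (simp add: directed_def)
    have g: "order_iso B A ?g" by (rule order_iso_inv[OF iso])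
    then have gD: "directed A (?g ` D)"
      using D order_iso_isotone order_isoD(3)
      by (intro directed_image) (blast intro: equalityD1)+
    then obtain s where s: "is_lub A s (?g ` D)"
      using \<open>A \<in> DCPO\<close> unfolding DCPO_def by blast
    have "is_lub B (f s) (f ` ?g ` D)"
      using order_iso_is_lub[OF iso _ s] gD by (simp add: directed_def)
    then show ?thesis using image_inv_into_cancel[OF refl Dc] by auto
  qed
  then show ?thesis using order_isoD(2)[OF iso] by (simp add: DCPO_def)
qed

text \<open>\<open>E2\<close> contains only dcpos whose carriers lie in the test universe, so
  \<open>H\<close> and \<open>H_hat\<close> have to be copied there. For injective \<open>j\<close>
  the global inverse \<open>inv j\<close> recovers the original point on the image of the
  carrier.\<close>

definition image_order :: "('a \<Rightarrow> 'b) \<Rightarrow> 'a gorder \<Rightarrow> 'b gorder" where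
  "image_order j L = \<lparr>carrier = j ` carrier L, eq = (=), le = (\<lambda>x y. inv j x \<sqsubseteq>\<^bsub>L\<^esub> inv j y)\<rparr>"

lemma carrier_image_order [simp]: "carrier (image_order j L) = j ` carrier L"
  by (simp add: image_order_def)

lemma le_image_order [simp]: "x \<sqsubseteq>\<^bsub>image_order j L\<^esub> y \<longleftrightarrow> inv j x \<sqsubseteq>\<^bsub>L\<^esub> inv j y"
  by (simp add: image_order_def)

lemma order_iso_image_order:
  assumes j: "inj j" and "partial_order L"
  shows "order_iso L (image_order j L) j"
proof -
  interpret partial_order L by fact
  have inv: "j (inv j x) = x \<and> inv j x \<in> carrier L" if "x \<in> j ` carrier L" for x
    using that j by auto
  have "partial_order (image_order j L)"
  proof (rule partial_orderI)
    fix x y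
    assume "x \<sqsubseteq>\<^bsub>image_order j L\<^esub> y" "y \<sqsubseteq>\<^bsub>image_order j L\<^esub> x"
      and xy: "x \<in> carrier (image_order j L)" "y \<in> carrier (image_order j L)"
    then have "inv j x = inv j y"
      using weak_le_antisym[of "inv j x" "inv j y"] inv by (simp add: eq_is_equal)
    then show "x = y" using inv xy by (metis carrier_image_order)
  next
    fix x y z
    assume "x \<sqsubseteq>\<^bsub>image_order j L\<^esub> y" "y \<sqsubseteq>\<^bsub>image_order j L\<^esub> z" "x \<in> carrier (image_order j L)"
      "y \<in> carrier (image_order j L)" "z \<in> carrier (image_order j L)"
    then show "x \<sqsubseteq>\<^bsub>image_order j L\<^esub> z"
      using le_trans[of "inv j x" "inv j y" "inv j z"] inv by simp
  qed (simp_all add: image_order_def inv)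
  then show ?thesis using assms by (simp add: order_iso_def)
qed

lemma order_iso_inv_image_order:
  assumes "inj j" "partial_order L"
  shows "order_iso (image_order j L) L (inv j)"
  using assms order_isoD(2)[OF order_iso_image_order[OF assms]] by (simp add: order_iso_def)

section \<open>Function spaces and a criterion for membership in \<open>E2\<close>\<close>

lemma partial_order_fun_dcpo:
  assumes "partial_order B"
  shows "partial_order (fun_dcpo A B)"
proof -
  interpret B: partial_order B by fact
  have c: "f x \<in> carrier B" if "f \<in> scott_maps A B" "x \<in> carrier A" for f x
    using that by (auto simp: scott_maps_def)
  show ?thesis
  proof (rule partial_orderI)
    fix f g
    assume "f \<sqsubseteq>\<^bsub>fun_dcpo A B\<^esub> g" "g \<sqsubseteq>\<^bsub>fun_dcpo A B\<^esub> f"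
      and fg: "f \<in> carrier (fun_dcpo A B)" "g \<in> carrier (fun_dcpo A B)"
    then have "f x = g x" if "x \<in> carrier A" for x
      using that c B.weak_le_antisym[of "f x" "g x"] by (simp add: fun_dcpo_def B.eq_is_equal)
    then show "f = g"
      using fg by (intro extensionalityI[of _ "carrier A"])
        (auto simp: fun_dcpo_def scott_maps_def PiE_def)
  next
    fix f g h
    assume "f \<sqsubseteq>\<^bsub>fun_dcpo A B\<^esub> g" "g \<sqsubseteq>\<^bsub>fun_dcpo A B\<^esub> h" "f \<in> carrier (fun_dcpo A B)"
      "g \<in> carrier (fun_dcpo A B)" "h \<in> carrier (fun_dcpo A B)"
    then show "f \<sqsubseteq>\<^bsub>fun_dcpo A B\<^esub> h"
      using c unfolding fun_dcpo_def by simp (metis B.le_trans)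
  qed (auto simp: fun_dcpo_def c)
qed

lemma partial_order_two: "partial_order two"
  by (rule partial_orderI) (auto simp: two_def)

text \<open>A supremum in the two-element chain is a disjunction. Hence Scott continuity into
  \<open>two\<close> asks that the supremum of a directed set be sent to \<open>True\<close> exactly
  when some member is.\<close>

lemma is_lub_two_iff: "is_lub two b B \<longleftrightarrow> b = (True \<in> B)"
proof -
  have "Upper two B = {u. True \<in> B \<longrightarrow> u}"
    by (auto simp: Upper_def two_def)
  then show ?thesis by (auto simp: least_def two_def)
qed

text \<open>In terms of Scott-open sets, \<open>surj\<close> says that every open set of
  \<open>A\<close> is the preimage of one of \<open>B\<close>, and \<open>refl\<close> that
  inclusions between preimages come from inclusions in \<open>B\<close>. This makes precomposition
  an order isomorphism, which suffices by \<open>order_iso_dcpo_iso\<close>.\<close>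

lemma E2I:
  assumes A: "A \<in> DCPO" and B: "B \<in> DCPO" and e: "e \<in> scott_maps A B"
    and surj: "\<And>f. f \<in> scott_maps A two \<Longrightarrow>
      \<exists>g\<in>scott_maps B two. \<forall>x\<in>carrier A. g (e x) = f x"
    and refl: "\<And>g g' y. g \<in> scott_maps B two \<Longrightarrow> g' \<in> scott_maps B two \<Longrightarrow>
      (\<And>x. x \<in> carrier A \<Longrightarrow> g (e x) \<longrightarrow> g' (e x)) \<Longrightarrow> y \<in> carrier B \<Longrightarrow> g y \<Longrightarrow> g' y"
  shows "(A, B, e) \<in> E2"
proof -
  let ?P = "precomp A B two e"
  have P: "?P g = compose (carrier A) g e" if "g \<in> scott_maps B two" for g
    using that by (simp add: precomp_def)
  have le2: "x \<sqsubseteq>\<^bsub>two\<^esub> y \<longleftrightarrow> (x \<longrightarrow> y)" for x y by (auto simp: two_def)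
  have "order_iso (fun_dcpo B two) (fun_dcpo A two) ?P"
    unfolding order_iso_def
  proof (intro conjI ballI partial_order_fun_dcpo partial_order_two)
    have "f \<in> ?P ` scott_maps B two" if f: "f \<in> scott_maps A two" for f
    proof -
      obtain g where g: "g \<in> scott_maps B two" "\<forall>x\<in>carrier A. g (e x) = f x"
        using surj[OF f] by blast
      have "f = compose (carrier A) g e"
        using f g by (intro extensionalityI[of _ "carrier A"])
          (auto simp: compose_def scott_maps_def PiE_def)
      then show ?thesis using P[OF g(1)] g(1) by (intro image_eqI[of _ _ g]) simp_all
    qed
    then show "?P ` carrier (fun_dcpo B two) = carrier (fun_dcpo A two)"
      using P scott_maps_compose[OF e] by (auto simp: fun_dcpo_def)
  next
    fix g g' assume "g \<in> carrier (fun_dcpo B two)" "g' \<in> carrier (fun_dcpo B two)"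
    then have g: "g \<in> scott_maps B two" "g' \<in> scott_maps B two" by (auto simp: fun_dcpo_def)
    moreover have "e x \<in> carrier B" if "x \<in> carrier A" for x
      using e that by (auto simp: scott_maps_def)
    ultimately show "?P g \<sqsubseteq>\<^bsub>fun_dcpo A two\<^esub> ?P g' \<longleftrightarrow> g \<sqsubseteq>\<^bsub>fun_dcpo B two\<^esub> g'"
      using refl[OF g] by (auto simp: P fun_dcpo_def compose_def le2)
  qed
  then have "dcpo_iso (fun_dcpo B two) (fun_dcpo A two) ?P"
    by (rule order_iso_dcpo_iso) (auto simp: precomp_def fun_dcpo_def)
  then show ?thesis using A B e by (simp add: E2_def)
qed

text \<open>The extension comes from the inverse map \<open>k\<close>. It serves twice: with
  \<open>C = two\<close> to transport \<open>E2\<close>, and at the end to extend the copy of the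
  identity of \<open>H\<close>.\<close>

lemma precomp_iso_extension:
  assumes "dcpo_iso (fun_dcpo B C) (fun_dcpo A C) (precomp A B C e)" "f \<in> scott_maps A C"
  shows "\<exists>g\<in>scott_maps B C. \<forall>x\<in>carrier A. g (e x) = f x"
proof -
  obtain k where k: "k \<in> scott_maps (fun_dcpo A C) (fun_dcpo B C)"
    "\<forall>f\<in>carrier (fun_dcpo A C). precomp A B C e (k f) = f"
    using assms(1) unfolding dcpo_iso_def by blast
  have "k f \<in> scott_maps B C" using k(1) assms(2) by (auto simp: scott_maps_def fun_dcpo_def)
  moreover have "precomp A B C e (k f) = f" using k(2) assms(2) by (simp add: fun_dcpo_def)
  ultimately have "k f \<in> scott_maps B C" "compose (carrier A) (k f) e = f"
    by (auto simp: precomp_def)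
  then show ?thesis by (metis compose_eq)
qed

text \<open>The inverse of precomposition is monotone, so applying it to the two restrictions
  returns the inequality on \<open>B\<close>. With \<open>C = two\<close> this supplies the
  condition \<open>refl\<close> of \<open>E2I\<close>.\<close>

lemma precomp_iso_reflects_le:
  assumes iso: "dcpo_iso (fun_dcpo B C) (fun_dcpo A C) (precomp A B C e)"
    and e: "e \<in> scott_maps A B"
    and g: "g \<in> scott_maps B C" "g' \<in> scott_maps B C"
    and le: "\<And>x. x \<in> carrier A \<Longrightarrow> g (e x) \<sqsubseteq>\<^bsub>C\<^esub> g' (e x)" and y: "y \<in> carrier B"
  shows "g y \<sqsubseteq>\<^bsub>C\<^esub> g' y"
proof -
  let ?P = "precomp A B C e"
  obtain k where k: "k \<in> scott_maps (fun_dcpo A C) (fun_dcpo B C)"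
    "\<forall>h\<in>carrier (fun_dcpo B C). k (?P h) = h"
    using iso unfolding dcpo_iso_def by blast
  have "?P g \<sqsubseteq>\<^bsub>fun_dcpo A C\<^esub> ?P g'" "?P g \<in> carrier (fun_dcpo A C)"
    "?P g' \<in> carrier (fun_dcpo A C)"
    using g le scott_maps_compose[OF e] by (auto simp: precomp_def fun_dcpo_def compose_def)
  then have "k (?P g) \<sqsubseteq>\<^bsub>fun_dcpo B C\<^esub> k (?P g')"
    using k(1) unfolding scott_maps_def isotone_def by blast
  then show ?thesis using k(2) g y by (simp add: fun_dcpo_def)
qed

text \<open>Conjugation by the order isomorphisms \<open>j\<close> and \<open>inv j\<close> between
  the dcpos and their copies turns each condition of \<open>E2I\<close> into the corresponding
  property of \<open>e\<close>.\<close>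

lemma E2_image_order:
  fixes j :: "'a \<Rightarrow> 'u" and A B :: "'a gorder"
  assumes j: "inj j" and AB: "(A, B, e) \<in> E2"
  shows "(image_order j A, image_order j B, \<lambda>x\<in>j ` carrier A. j (e (inv j x))) \<in> E2"
    (is "(?A, ?B, ?e) \<in> E2")
proof (rule E2I)
  have E: "A \<in> DCPO" "B \<in> DCPO" "e \<in> scott_maps A B"
    and iso: "dcpo_iso (fun_dcpo B two) (fun_dcpo A two) (precomp A B two e)"
    using AB by (auto simp: E2_def)
  have ec: "e x \<in> carrier B" if "x \<in> carrier A" for x
    using E(3) that by (auto simp: scott_maps_def)
  have po: "partial_order A" "partial_order B" using E by (simp_all add: DCPO_def)
  note jA = order_iso_image_order[OF j po(1)] and jB = order_iso_image_order[OF j po(2)]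
    and iA = order_iso_inv_image_order[OF j po(1)] and iB = order_iso_inv_image_order[OF j po(2)]
  show "?A \<in> DCPO" "?B \<in> DCPO"
    using order_iso_DCPO[OF jA E(1)] order_iso_DCPO[OF jB E(2)] .
  show "?e \<in> scott_maps ?A ?B"
    by (rule scott_maps_cong[OF scott_maps_compose[OF order_iso_scott_map[OF iA]
          scott_maps_compose[OF E(3) order_iso_scott_map[OF jB]]]])
      (use j ec in \<open>auto simp: compose_def\<close>)
  show "\<exists>g\<in>scott_maps ?B two. \<forall>x\<in>carrier ?A. g (?e x) = f x" if f: "f \<in> scott_maps ?A two" for f
  proof -
    obtain g where g: "g \<in> scott_maps B two" "\<forall>x\<in>carrier A. g (e x) = f (j x)"
      using precomp_iso_extension[OF iso scott_maps_compose[OF order_iso_scott_map[OF jA] f]]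
      by (auto simp: compose_def)
    then show ?thesis
      using j ec by (intro bexI[OF _ scott_maps_compose[OF order_iso_scott_map[OF iB] g(1)]])
        (auto simp: compose_def)
  qed
  show "g' y" if g: "g \<in> scott_maps ?B two" "g' \<in> scott_maps ?B two"
    and le: "\<And>x. x \<in> carrier ?A \<Longrightarrow> g (?e x) \<longrightarrow> g' (?e x)" and y: "y \<in> carrier ?B" "g y"
  for g g' y
  proof -
    obtain x where x: "y = j x" "x \<in> carrier B" using y(1) by auto
    have "compose (carrier B) g (restrict j (carrier B)) x \<sqsubseteq>\<^bsub>two\<^esub>
        compose (carrier B) g' (restrict j (carrier B)) x"
    proof (rule precomp_iso_reflects_le[OF iso E(3)])
      fix a assume a: "a \<in> carrier A"
      then have "g (j (e a)) \<longrightarrow> g' (j (e a))" using le[of "j a"] j by simp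
      then show "compose (carrier B) g (restrict j (carrier B)) (e a) \<sqsubseteq>\<^bsub>two\<^esub>
          compose (carrier B) g' (restrict j (carrier B)) (e a)"
        using ec[OF a] by (simp add: compose_def two_def)
    qed (rule x scott_maps_compose[OF order_iso_scott_map[OF jB]] g)+
    then show ?thesis using x y by (simp add: compose_def two_def)
  qed
qed

section \<open>The order of \<open>H\<close> and of its completion\<close>

text \<open>On strings over \<open>Npos\<close> this is the reflexive closure of what
  \<open>lt1\<close> does to the string component.\<close>

definition head_le :: "nat list \<Rightarrow> nat list \<Rightarrow> bool" where
  "head_le x y \<longleftrightarrow> x = y \<or> (\<exists>n n' s. x = n # s \<and> y = n' # s \<and> n < n')"

text \<open>The added element \<open>\<top>\<^sub>s\<close> is encoded as \<open>(0, s)\<close>; since \<open>0\<close> is not in \<open>Npos\<close>, the same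
  formula describes the order on \<open>H\<close> and on its completion.\<close>

definition hle :: "nat \<times> nat list \<Rightarrow> nat \<times> nat list \<Rightarrow> bool" where
  "hle p q \<longleftrightarrow> (\<exists>t z. snd p = t @ z \<and> head_le z (snd q) \<and>
     (fst p = fst q \<or> fst q = 0 \<or> (\<exists>k\<in>set t. k \<le> fst q)))"

lemma hleI:
  assumes "head_le z y" "m = m' \<or> m' = 0 \<or> (\<exists>k\<in>set t. k \<le> m')"
  shows "hle (m, t @ z) (m', y)"
  unfolding hle_def using assms by (intro exI[of _ t] exI[of _ z]) simp

lemma head_le_refl [simp]: "head_le x x"
  by (simp add: head_le_def)

lemma head_le_length: "head_le x y \<Longrightarrow> length x = length y"
  by (auto simp: head_le_def)

lemma head_le_trans: "head_le x y \<Longrightarrow> head_le y z \<Longrightarrow> head_le x z"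
  by (auto simp: head_le_def)

lemma head_le_antisym: "head_le x y \<Longrightarrow> head_le y x \<Longrightarrow> x = y"
  by (auto simp: head_le_def)

text \<open>Only the first entry can change; it lies in the nonempty prefix \<open>t\<close>, and
  \<open>z\<close> has the smaller one. Lowering an entry keeps every bound that some entry
  satisfied, so a raise of the head can be absorbed into a later deletion of a prefix.\<close>

lemma head_le_append:
  assumes "head_le z (t @ y)" "t \<noteq> []"
  shows "\<exists>t'. z = t' @ y \<and> (\<forall>m. (\<exists>k\<in>set t. k \<le> m) \<longrightarrow> (\<exists>k\<in>set t'. k \<le> m))"
proof -
  consider "z = t @ y" | n n' s where "z = n # s" "t @ y = n' # s" "n < n'"
    using assms(1) unfolding head_le_def by auto
  then show ?thesis
  proof cases
    case 1
    then show ?thesis by auto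
  next
    case 2
    then obtain u where "t = n' # u" "s = u @ y" using assms(2) by (cases t) auto
    then show ?thesis using 2 by (intro exI[of _ "n # u"]) auto
  qed
qed

lemma hle_refl: "hle p p"
  using hleI[of "snd p" "snd p" "fst p" "fst p" "[]"] by simp

lemma hle_length: "hle p q \<Longrightarrow> length (snd q) \<le> length (snd p)"
  by (auto simp: hle_def dest: head_le_length)

lemma hle_same_length:
  assumes "hle p q" "length (snd p) \<le> length (snd q)"
  shows "head_le (snd p) (snd q)" "fst p = fst q \<or> fst q = 0"
proof -
  obtain t z where t: "snd p = t @ z" "head_le z (snd q)"
    "fst p = fst q \<or> fst q = 0 \<or> (\<exists>k\<in>set t. k \<le> fst q)"
    using assms(1) unfolding hle_def by blast
  moreover have "t = []" using t assms(2) head_le_length by fastforce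
  ultimately show "head_le (snd p) (snd q)" "fst p = fst q \<or> fst q = 0" by auto
qed

text \<open>Lengths do not grow along \<open>hle\<close>, so in a cycle they agree and nothing is
  deleted. The strings are then equal by antisymmetry of \<open>head_le\<close>, and the indices
  because an index can change only to 0.\<close>

lemma hle_antisym:
  assumes "hle p q" "hle q p"
  shows "p = q"
  using hle_same_length[OF assms(1) hle_length[OF assms(2)]]
    hle_same_length[OF assms(2) hle_length[OF assms(1)]]
  by (auto intro: prod_eqI head_le_antisym)

lemma hle_trans:
  assumes "hle p q" "hle q r"
  shows "hle p r"
proof -
  obtain t z where 1: "snd p = t @ z" "head_le z (snd q)"
    "fst p = fst q \<or> fst q = 0 \<or> (\<exists>k\<in>set t. k \<le> fst q)"
    using assms(1) unfolding hle_def by blast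
  obtain t' z' where 2: "snd q = t' @ z'" "head_le z' (snd r)"
    "fst q = fst r \<or> fst r = 0 \<or> (\<exists>k\<in>set t'. k \<le> fst r)"
    using assms(2) unfolding hle_def by blast
  \<comment> \<open>If the second comparison deletes nothing, the two head comparisons compose;
    otherwise \<open>head_le_append\<close> moves the first one into the deleted prefix.\<close>
  show ?thesis
  proof (cases "t' = []")
    case True
    then show ?thesis using 1 2 head_le_trans unfolding hle_def by fastforce
  next
    case False
    then obtain u where u: "z = u @ z'"
      "\<forall>m. (\<exists>k\<in>set t'. k \<le> m) \<longrightarrow> (\<exists>k\<in>set u. k \<le> m)"
      using head_le_append 1(2) 2(1) by metis
    have "fst p = fst r \<or> fst r = 0 \<or> (\<exists>k\<in>set (t @ u). k \<le> fst r)"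
      using 1(3) 2(3) u(2) by auto
    then show ?thesis using 1(1) u(1) 2(2) unfolding hle_def by (metis append.assoc)
  qed
qed

text \<open>The string part of \<open>hle\<close> ignores the indices, and equal indices satisfy the
  rest. This replaces a comparison with a level supremum by one inside a single index.\<close>

lemma hle_level: "hle (m, x) (m', y) \<Longrightarrow> hle (k, x) (k, y)"
  by (auto simp: hle_def)

lemma hle_head: "n \<le> n' \<Longrightarrow> hle (m, n # s) (m, n' # s)"
proof -
  assume "n \<le> n'"
  then have "head_le (n # s) (n' # s)" by (auto simp: head_le_def)
  then show ?thesis using hleI[of "n # s" "n' # s" m m "[]"] by simp
qed

lemma hle_tail: "hle (m, n # s) (m, s)"
  using hleI[of s s m m "[n]"] by simp

lemma hle_chain_upper_bound:
  assumes "infinite N" "\<And>n. n \<in> N \<Longrightarrow> hle (m, n # s) q"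
  shows "hle (m, s) q"
proof -
  \<comment> \<open>Take \<open>n\<close> above both the index of \<open>q\<close> and the head of
    its string. Then \<open>n\<close> cannot be raised to that head, so it is deleted; nor can it be
    the small entry of the deleted prefix, so such an entry, if needed, already lies in
    \<open>s\<close>. If the string of \<open>q\<close> is empty, \<open>hd\<close> is an arbitrary
    number, but the case \<open>Nil\<close> is then impossible because \<open>z\<close> is
    nonempty.\<close>
  obtain n where n: "n \<in> N" "Suc (fst q + hd (snd q)) \<le> n"
    using assms(1) unfolding infinite_nat_iff_unbounded_le by blast
  then obtain t z where t: "n # s = t @ z" "head_le z (snd q)"
    "m = fst q \<or> fst q = 0 \<or> (\<exists>k\<in>set t. k \<le> fst q)"
    using assms(2) unfolding hle_def by (metis fst_conv snd_conv)
  show ?thesis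
  proof (cases t)
    case Nil
    then have "n \<le> hd (snd q)"
      using t(1,2) by (cases "snd q") (auto simp: head_le_def)
    then show ?thesis using n(2) by simp
  next
    case (Cons a u)
    then have "s = u @ z" "a = n" using t(1) by auto
    then show ?thesis using t n(2) Cons unfolding hle_def by fastforce
  qed
qed

text \<open>One argument serves both \<open>H\<close>, with \<open>M = Npos\<close>, and
  \<open>H_hat\<close>, with \<open>M = UNIV\<close>. The order is compared with \<open>hle\<close>
  on the carrier only, since that of \<open>H\<close> differs from \<open>hle\<close>
  elsewhere.\<close>

locale H_levels =
  fixes L :: "(nat \<times> nat list) gorder" and M :: "nat set"
  assumes carrier_eq: "carrier L = M \<times> lists Npos"
    and eq_eq: "eq L = (=)"
    and le_iff: "p \<in> carrier L \<Longrightarrow> q \<in> carrier L \<Longrightarrow> p \<sqsubseteq>\<^bsub>L\<^esub> q \<longleftrightarrow> hle p q"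
begin

lemma partial_order: "partial_order L"
  by (rule partial_orderI[OF eq_eq]) (use le_iff hle_refl hle_antisym hle_trans in blast)+

text \<open>In case of a chain, the supremum of \<open>D\<close> is \<open>(m, s)\<close>.\<close>

lemma directed_cases:
  assumes D: "directed L D"
  obtains (max) d where "d \<in> D" "\<And>x. x \<in> D \<Longrightarrow> x \<sqsubseteq>\<^bsub>L\<^esub> d"
  | (chain) m s N where "infinite N" "(m, s) \<in> carrier L" "\<And>n. n \<in> N \<Longrightarrow> (m, n # s) \<in> D"
      "\<And>d. d \<in> D \<Longrightarrow> \<exists>n\<in>N. d \<sqsubseteq>\<^bsub>L\<^esub> (m, n # s)"
proof -
  have Dc: "D \<subseteq> carrier L" and "D \<noteq> {}" using D by (auto simp: directed_def)
  \<comment> \<open>The measure compares string lengths first and breaks ties by whether the index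
    is nonzero. Going up in \<open>hle\<close>, the length cannot grow, and at equal length the
    index can only become 0. So elements of \<open>D\<close> above a minimiser \<open>d0\<close>
    keep its length and index.\<close>
  define f :: "nat \<times> nat list \<Rightarrow> nat" where "f p = 2 * length (snd p) + of_bool (fst p \<noteq> 0)" for p
  obtain d0 where d0: "d0 \<in> D" and min: "\<And>d. d \<in> D \<Longrightarrow> f d0 \<le> f d"
    using \<open>D \<noteq> {}\<close> ex_has_least_nat[of "\<lambda>d. d \<in> D" _ f] by blast
  obtain m x where mx: "d0 = (m, x)" by (cases d0)
  have above: "fst d = m \<and> head_le x (snd d)" if "d \<in> D" "hle d0 d" for d
  proof -
    have "f d0 \<le> f d" "length (snd d) \<le> length x"
      using min that hle_length[OF that(2)] by (auto simp: mx)
    then have "length x \<le> length (snd d)" by (auto simp: f_def mx of_bool_def split: if_splits)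
    then show ?thesis
      using hle_same_length[OF that(2)] \<open>f d0 \<le> f d\<close> \<open>length (snd d) \<le> length x\<close>
      by (auto simp: mx f_def of_bool_def split: if_splits)
  qed
  have cofinal: "\<exists>d'\<in>D. hle d d' \<and> fst d' = m \<and> head_le x (snd d')" if d: "d \<in> D" for d
  proof -
    obtain d' where "d' \<in> D" "d \<sqsubseteq>\<^bsub>L\<^esub> d'" "d0 \<sqsubseteq>\<^bsub>L\<^esub> d'"
      using D d d0 unfolding directed_def by blast
    then have "hle d d'" "hle d0 d'" using le_iff Dc d d0 by blast+
    then show ?thesis using above \<open>d' \<in> D\<close> by blast
  qed
  show thesis
  proof (cases x)
    case Nil
    have "d \<sqsubseteq>\<^bsub>L\<^esub> d0" if d: "d \<in> D" for d
    proof -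
      obtain d' where "d' \<in> D" "hle d d'" "fst d' = m" "head_le x (snd d')"
        using cofinal[OF d] by blast
      then have "d' = d0" using Nil mx by (cases d') (auto simp: head_le_def)
      then show ?thesis using \<open>hle d d'\<close> le_iff Dc d d0 by blast
    qed
    then show thesis using max d0 by blast
  next
    case (Cons n0 s)
    \<comment> \<open>The members of \<open>D\<close> of the form \<open>(m, n # s)\<close> are
      cofinal in \<open>D\<close>, by \<open>cofinal\<close>. If their heads are bounded, the
      largest head gives a greatest element; otherwise they form the chain.\<close>
    define N where "N = {n. (m, n # s) \<in> D}"
    have cofN: "\<exists>n\<in>N. hle d (m, n # s)" if d: "d \<in> D" for d
    proof -
      obtain d' where "d' \<in> D" "hle d d'" "fst d' = m" "head_le x (snd d')"
        using cofinal[OF d] by blast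
      then show ?thesis using Cons by (cases d') (auto simp: head_le_def N_def)
    qed
    show thesis
    proof (cases "finite N")
      case True
      have "n0 \<in> N" using d0 mx Cons by (simp add: N_def)
      then have top: "(m, Max N # s) \<in> D" using Max_in[OF True] by (auto simp: N_def)
      moreover have "d \<sqsubseteq>\<^bsub>L\<^esub> (m, Max N # s)" if d: "d \<in> D" for d
      proof -
        obtain n where "n \<in> N" "hle d (m, n # s)" using cofN[OF d] by blast
        then have "hle d (m, Max N # s)"
          using hle_trans hle_head Max_ge[OF True] by metis
        then show ?thesis using le_iff Dc d top by blast
      qed
      ultimately show thesis using max by blast
    next
      case False
      have "(m, s) \<in> carrier L" using d0 Dc mx Cons carrier_eq by auto
      moreover have "\<exists>n\<in>N. d \<sqsubseteq>\<^bsub>L\<^esub> (m, n # s)" if d: "d \<in> D" for d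
      proof -
        obtain n where "n \<in> N" "hle d (m, n # s)" using cofN[OF d] by blast
        moreover from this have "(m, n # s) \<in> D" by (simp add: N_def)
        ultimately show ?thesis using le_iff[of d "(m, n # s)"] Dc d by blast
      qed
      moreover have "(m, n # s) \<in> D" if "n \<in> N" for n using that by (simp add: N_def)
      ultimately show thesis using chain[OF False] by blast
    qed
  qed
qed

lemma is_lub_chain:
  assumes "infinite N" "(m, s) \<in> carrier L" "D \<subseteq> carrier L" "\<And>n. n \<in> N \<Longrightarrow> (m, n # s) \<in> D"
    "\<And>d. d \<in> D \<Longrightarrow> \<exists>n\<in>N. d \<sqsubseteq>\<^bsub>L\<^esub> (m, n # s)"
  shows "is_lub L (m, s) D"
proof -
  have "d \<sqsubseteq>\<^bsub>L\<^esub> (m, s)" if d: "d \<in> D" for d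
  proof -
    obtain n where "n \<in> N" "d \<sqsubseteq>\<^bsub>L\<^esub> (m, n # s)" using assms(5) d by blast
    then have "hle d (m, n # s)" using le_iff assms(3,4) d by blast
    then have "hle d (m, s)" using hle_trans hle_tail by blast
    then show ?thesis using le_iff assms(2,3) d by blast
  qed
  moreover have "(m, s) \<sqsubseteq>\<^bsub>L\<^esub> u" if "u \<in> carrier L" "\<forall>d\<in>D. d \<sqsubseteq>\<^bsub>L\<^esub> u" for u
  proof -
    have "hle (m, n # s) u" if "n \<in> N" for n
      using that \<open>u \<in> carrier L\<close> \<open>\<forall>d\<in>D. d \<sqsubseteq>\<^bsub>L\<^esub> u\<close> le_iff assms(3,4) by blast
    then have "hle (m, s) u" using hle_chain_upper_bound assms(1) by blast
    then show ?thesis using le_iff assms(2) that(1) by blast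
  qed
  ultimately show ?thesis using assms by (simp add: is_lub_iff)
qed

lemma DCPO: "L \<in> DCPO"
proof -
  have "\<exists>s. is_lub L s D" if D: "directed L D" for D
  proof -
    have Dc: "D \<subseteq> carrier L" using D by (simp add: directed_def)
    show ?thesis using D
    proof (cases rule: directed_cases)
      case (max d)
      then have "is_lub L d D" using Dc by (auto simp: is_lub_iff)
      then show ?thesis by blast
    next
      case (chain m s N)
      then show ?thesis using is_lub_chain[of N m s D] Dc by blast
    qed
  qed
  then show ?thesis using partial_order by (simp add: DCPO_def)
qed

text \<open>These conditions describe the Scott-open sets. By \<open>directed_cases\<close> a
  directed set without a greatest element has a cofinal chain of points \<open>(m, n # s)\<close>,
  so inaccessibility need only be tested on the full chain below each \<open>(m, s)\<close>.\<close>

lemma scott_maps_two_iff: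
  "g \<in> scott_maps L two \<longleftrightarrow> g \<in> extensional (carrier L) \<and>
     (\<forall>p\<in>carrier L. \<forall>q\<in>carrier L. hle p q \<longrightarrow> g p \<longrightarrow> g q) \<and>
     (\<forall>m s. (m, s) \<in> carrier L \<longrightarrow> g (m, s) \<longrightarrow> (\<exists>n\<in>Npos. g (m, n # s)))"
  (is "_ \<longleftrightarrow> ?ext \<and> ?mono \<and> ?open")
proof (intro iffI conjI)
  have le2: "x \<sqsubseteq>\<^bsub>two\<^esub> y \<longleftrightarrow> (x \<longrightarrow> y)" for x y by (auto simp: two_def)
  {
    assume g: "g \<in> scott_maps L two"
    show ?ext using g by (simp add: scott_maps_def PiE_def)
    show ?mono
    proof (intro ballI impI)
      fix p q assume pq: "p \<in> carrier L" "q \<in> carrier L" "hle p q" "g p"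
      have "g p \<sqsubseteq>\<^bsub>two\<^esub> g q"
        using g le_iff[of p q] pq(1-3) by (simp add: scott_maps_def isotone_def)
      then show "g q" using pq(4) by (simp add: le2)
    qed
    show ?open
    proof (intro allI impI)
      fix m s assume ms: "(m, s) \<in> carrier L" "g (m, s)"
      let ?D = "(\<lambda>n. (m, n # s)) ` Npos"
      have Dc: "?D \<subseteq> carrier L" using ms by (auto simp: carrier_eq)
      have inf: "infinite Npos" by (simp add: Npos_def infinite_Ici)
      have le: "(m, n # s) \<sqsubseteq>\<^bsub>L\<^esub> (m, n' # s)" if "n \<le> n'" "n \<in> Npos" "n' \<in> Npos" for n n'
        by (rule le_iff[THEN iffD2, OF _ _ hle_head[OF that(1)]]) (use that Dc in auto)
      have "is_lub L (m, s) ?D"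
        using inf ms Dc le by (intro is_lub_chain[of Npos]) auto
      moreover have "directed L ?D"
        unfolding directed_def
      proof (intro conjI ballI)
        show "?D \<noteq> {}" using inf by auto
        fix x y assume "x \<in> ?D" "y \<in> ?D"
        then obtain a b where "x = (m, a # s)" "y = (m, b # s)" "a \<in> Npos" "b \<in> Npos" by auto
        moreover have "max a b \<in> Npos" using calculation by (auto simp: max_def)
        ultimately show "\<exists>z\<in>?D. x \<sqsubseteq>\<^bsub>L\<^esub> z \<and> y \<sqsubseteq>\<^bsub>L\<^esub> z"
          using le by (intro bexI[of _ "(m, max a b # s)"]) auto
      qed (rule Dc)
      ultimately have "is_lub two (g (m, s)) (g ` ?D)"
        using g by (simp add: scott_maps_def)
      then show "\<exists>n\<in>Npos. g (m, n # s)" using ms(2) by (auto simp: is_lub_two_iff)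
    qed
  }
  assume *: "?ext \<and> ?mono \<and> ?open"
  have lub: "is_lub two (g s) (g ` D)" if D: "directed L D" and s: "is_lub L s D" for D s
  proof -
    have Dc: "D \<subseteq> carrier L" using D by (simp add: directed_def)
    have sc: "s \<in> carrier L" "\<And>d. d \<in> D \<Longrightarrow> hle d s"
      using s Dc le_iff unfolding is_lub_iff[OF Dc] by blast+
    have "\<exists>d\<in>D. g d" if "g s" using D
    proof (cases rule: directed_cases)
      case (max d)
      then have "s \<sqsubseteq>\<^bsub>L\<^esub> d" using s Dc unfolding is_lub_iff[OF Dc] by blast
      then show ?thesis using * \<open>g s\<close> sc(1) max(1) Dc le_iff by blast
    next
      case (chain m s' N)
      then have "s = (m, s')"
        using is_lub_unique[OF partial_order s] is_lub_chain[of N m s' D] Dc by blast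
      then obtain n where n: "n \<in> Npos" "g (m, n # s')" using * \<open>g s\<close> sc(1) by blast
      \<comment> \<open>The head \<open>n\<close> given by openness need not lie in
        \<open>N\<close>. As \<open>N\<close> is unbounded, some larger head does, and upward
        closure passes to it.\<close>
      obtain n' where n': "n' \<in> N" "n \<le> n'"
        using chain(1) unfolding infinite_nat_iff_unbounded_le by blast
      have "(m, n # s') \<in> carrier L" using n chain(2) by (auto simp: carrier_eq)
      then have "g (m, n' # s')"
        using * n(2) n' hle_head chain(3) Dc by blast
      then show ?thesis using chain(3) n' by blast
    qed
    moreover have "g s" if "d \<in> D" "g d" for d using * sc Dc that by blast
    ultimately show ?thesis by (auto simp: is_lub_two_iff)
  qed
  have "isotone L two g"
    using partial_order partial_order_two * le_iff
    by (simp add: partial_order_def isotone_def le2)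
  moreover have "g \<in> carrier L \<rightarrow>\<^sub>E carrier two"
    using * by (simp add: two_def PiE_def)
  ultimately show "g \<in> scott_maps L two" using lub by (simp add: scott_maps_def)
qed

end

section \<open>Agreement of the order of \<open>H\<close> with \<open>hle\<close> on the
  carrier\<close>

lemma H_less_imp_hle:
  assumes "(p, q) \<in> H_less"
  shows "hle p q"
proof -
  have 1: "hle p q" if "(p, q) \<in> lt1" for p q
    using that hle_head by (fastforce simp: lt1_def)
  have 2: "hle p q" if "(p, q) \<in> lt2" for p q
    using that by (auto simp: lt2_def intro: hleI)
  have 3: "hle p q" if pq: "(p, q) \<in> lt3" for p q
  proof -
    obtain m m' t s where "p = (m, t @ s)" "q = (m', s)" "t \<noteq> []" "Min (set t) \<le> m'"
      using pq unfolding lt3_def by blast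
    moreover from this have "Min (set t) \<in> set t" by (intro Min_in) auto
    ultimately show ?thesis by (auto intro: hleI)
  qed
  show ?thesis using assms 1 2 3 hle_trans unfolding H_less_def by blast
qed

text \<open>Index 0 does not occur in the carrier, so the alternative of a level supremum is void.
  What remains is the deletion of a prefix, by \<open>lt2\<close> or \<open>lt3\<close>, followed by
  a raise of the head, by \<open>lt1\<close>; either may be trivial, but not both.\<close>

lemma hle_imp_H_less:
  assumes p: "p \<in> H_carrier" and q: "q \<in> H_carrier" and hle: "hle p q" and "p \<noteq> q"
  shows "(p, q) \<in> H_less"
proof -
  obtain m x m' y where pq: "p = (m, x)" "q = (m', y)" by fastforce
  obtain t z where t: "x = t @ z" "head_le z y" "m = m' \<or> m' = 0 \<or> (\<exists>k\<in>set t. k \<le> m')"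
    using hle unfolding hle_def pq by auto
  have c: "m \<in> Npos" "m' \<in> Npos" "t \<in> lists Npos" "z \<in> lists Npos" "y \<in> lists Npos" "m' \<noteq> 0"
    using p q t by (auto simp: H_carrier_def pq Npos_def)
  have lt1: "z = y \<or> ((m', z), (m', y)) \<in> lt1"
    using t(2) c unfolding head_le_def lt1_def by auto
  show ?thesis
  proof (cases "t = []")
    case True
    then show ?thesis using lt1 t \<open>p \<noteq> q\<close> c by (auto simp: pq H_less_def)
  next
    case False
    have "((m, x), (m', z)) \<in> lt2 \<union> lt3"
    proof (cases "m = m'")
      case True
      then show ?thesis using False t(1) c by (auto simp: lt2_def)
    next
      case neq: False
      then obtain k where "k \<in> set t" "k \<le> m'" using t(3) c by auto
      then have "Min (set t) \<le> m'" by (meson List.finite_set Min_le order_trans)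
      then show ?thesis using False t(1) c by (auto simp: lt3_def)
    qed
    then show ?thesis using lt1 by (auto simp: pq H_less_def)
  qed
qed

section \<open>The completion \<open>H_hat\<close> and the inclusion of \<open>H\<close>\<close>

definition H_hat :: "(nat \<times> nat list) gorder" where
  "H_hat = \<lparr>carrier = UNIV \<times> lists Npos, eq = (=), le = hle\<rparr>"

interpretation H: H_levels H Npos
proof
  fix p q assume "p \<in> carrier H" "q \<in> carrier H"
  then have "p \<in> H_carrier" "q \<in> H_carrier" by (simp_all add: H_def)
  then have "(p, q) \<in> H_less \<or> p = q \<longleftrightarrow> hle p q"
    using H_less_imp_hle hle_imp_H_less hle_refl by blast
  then show "p \<sqsubseteq>\<^bsub>H\<^esub> q \<longleftrightarrow> hle p q" by (simp add: H_def)
qed (auto simp: H_def H_carrier_def)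

interpretation H_hat: H_levels H_hat UNIV
  by unfold_locales (auto simp: H_hat_def)

lemma H_inclusion_E2: "(H, H_hat, \<lambda>p\<in>carrier H. p) \<in> E2"
proof (rule E2I)
  have sub: "p \<in> carrier H_hat" if "p \<in> carrier H" for p
    using that by (auto simp: H.carrier_eq H_hat.carrier_eq)
  have le_eq: "p \<sqsubseteq>\<^bsub>H_hat\<^esub> q \<longleftrightarrow> p \<sqsubseteq>\<^bsub>H\<^esub> q" if "p \<in> carrier H" "q \<in> carrier H" for p q
    using H.le_iff[OF that] H_hat.le_iff[OF that[THEN sub]] by simp
  show "H \<in> DCPO" "H_hat \<in> DCPO" by (rule H.DCPO H_hat.DCPO)+
  show "(\<lambda>p\<in>carrier H. p) \<in> scott_maps H H_hat"
  proof -
    \<comment> \<open>A directed set of \<open>H\<close> has a greatest element or a cofinal chain,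
      and in either case its supremum is the same point in \<open>H_hat\<close>.\<close>
    have "is_lub H_hat s D" if D: "directed H D" and s: "is_lub H s D" for D s
    proof -
      have Dc: "D \<subseteq> carrier H" using D by (simp add: directed_def)
      then have Dh: "D \<subseteq> carrier H_hat" using sub by blast
      show ?thesis using D
      proof (cases rule: H.directed_cases)
        case (max d)
        then have "is_lub H d D" using Dc by (auto simp: is_lub_iff)
        then have "s = d" using is_lub_unique[OF H.partial_order s] by blast
        moreover have "\<And>x. x \<in> D \<Longrightarrow> x \<sqsubseteq>\<^bsub>H_hat\<^esub> d"
          using max Dc le_eq by blast
        ultimately show ?thesis using max Dh unfolding is_lub_iff[OF Dh] by blast
      next
        case (chain m s' N)
        then have "s = (m, s')"
          using is_lub_unique[OF H.partial_order s] H.is_lub_chain[of N m s' D] Dc by blast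
        moreover have "is_lub H_hat (m, s') D"
        proof (rule H_hat.is_lub_chain)
          show "\<exists>n\<in>N. d \<sqsubseteq>\<^bsub>H_hat\<^esub> (m, n # s')" if d: "d \<in> D" for d
          proof -
            obtain n where n: "n \<in> N" "d \<sqsubseteq>\<^bsub>H\<^esub> (m, n # s')" using chain(4)[OF d] by blast
            then have "d \<sqsubseteq>\<^bsub>H_hat\<^esub> (m, n # s')"
              using le_eq[of d "(m, n # s')"] chain(3)[OF n(1)] Dc d by blast
            then show ?thesis using n(1) by blast
          qed
        qed (rule chain(1) sub[OF chain(2)] Dh chain(3))+
        ultimately show ?thesis by simp
      qed
    qed
    moreover have "(\<lambda>p\<in>carrier H. p) ` D = D" if "directed H D" for D
      using that by (force simp: directed_def)
    moreover have "isotone H H_hat (\<lambda>p\<in>carrier H. p)"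
      using H.partial_order H_hat.partial_order
      by (simp add: partial_order_def isotone_def le_eq)
    moreover have "(\<lambda>p\<in>carrier H. p) \<in> carrier H \<rightarrow>\<^sub>E carrier H_hat"
      using sub by simp
    moreover have "(\<lambda>p\<in>carrier H. p) s = s" if "is_lub H s D" for s D
      using least_closed[OF that] by simp
    ultimately show ?thesis by (simp add: scott_maps_def)
  qed
  show "\<exists>g\<in>scott_maps H_hat two. \<forall>x\<in>carrier H. g ((\<lambda>p\<in>carrier H. p) x) = f x"
    if "f \<in> scott_maps H two" for f
  proof -
    have mono: "\<And>p q. p \<in> carrier H \<Longrightarrow> q \<in> carrier H \<Longrightarrow> hle p q \<Longrightarrow> f p \<Longrightarrow> f q"
      and opn: "\<And>m s. (m, s) \<in> carrier H \<Longrightarrow> f (m, s) \<Longrightarrow> \<exists>n\<in>Npos. f (m, n # s)"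
      using that unfolding H.scott_maps_two_iff by blast+
    \<comment> \<open>The open set given by \<open>f\<close> is enlarged by the suprema of exactly
      those levels that it meets.\<close>
    define g where "g = (\<lambda>(m, s)\<in>carrier H_hat. if m = 0 then \<exists>k\<in>Npos. f (k, s) else f (m, s))"
    have g0: "g (0, s) \<longleftrightarrow> (\<exists>k\<in>Npos. f (k, s))" if "s \<in> lists Npos" for s
      using that by (simp add: g_def H_hat.carrier_eq)
    have g1: "g (m, s) = f (m, s)" if "s \<in> lists Npos" "m \<noteq> 0" for m s
      using that by (simp add: g_def H_hat.carrier_eq)
    have H: "(m, s) \<in> carrier H" if "m \<noteq> 0" "s \<in> lists Npos" for m s
      using that by (simp add: H.carrier_eq Npos_def)
    have pos: "m \<noteq> 0" if "m \<in> Npos" for m using that by (auto simp: Npos_def)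
    have "g \<in> scott_maps H_hat two"
      unfolding H_hat.scott_maps_two_iff
    proof (intro conjI allI impI ballI)
      show "g \<in> extensional (carrier H_hat)" by (simp add: g_def)
    next
      fix p q assume pq: "p \<in> carrier H_hat" "q \<in> carrier H_hat" "hle p q" "g p"
      obtain m x m' y where [simp]: "p = (m, x)" "q = (m', y)" by fastforce
      have x: "x \<in> lists Npos" "y \<in> lists Npos" using pq by (auto simp: H_hat.carrier_eq)
      \<comment> \<open>A point with string \<open>x\<close> in the open set given by
        \<open>f\<close>: it is \<open>p\<close> itself if \<open>p\<close> lies in
        \<open>H\<close>, and otherwise some point below the level supremum
        \<open>p\<close>.\<close>
      obtain k where k: "k \<noteq> 0" "f (k, x)" "m \<noteq> 0 \<Longrightarrow> k = m"
      proof (cases "m = 0")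
        case True
        then have "g (0, x)" using pq(4) by simp
        then obtain k where "k \<in> Npos" "f (k, x)" using g0[OF x(1)] by blast
        then show thesis using that True pos by blast
      next
        case False
        then show thesis using that pq(4) g1[OF x(1)] by simp
      qed
      show "g q"
      proof (cases "m' = 0")
        case True
        have "hle (k, x) (k, y)" using hle_level pq(3) by simp
        then have "f (k, y)" using mono[OF H H _ k(2)] k(1) x by blast
        moreover have "k \<in> Npos" using k(1) by (simp add: Npos_def)
        ultimately show ?thesis using True g0[OF x(2)] by auto
      next
        case False
        \<comment> \<open>With \<open>m = 0\<close> and \<open>m'\<close> nonzero, only a small
          entry of the deleted prefix can justify \<open>hle p q\<close>, and this does not depend
          on the index on the left.\<close>
        have "hle (k, x) (m', y)"
          using pq(3) k(3) False unfolding hle_def by (cases "m = 0") auto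
        then have "f (m', y)" using mono[OF H H _ k(2)] k(1) x False by blast
        then show ?thesis using g1[OF x(2) False] by simp
      qed
    next
      fix m s assume ms: "(m, s) \<in> carrier H_hat" "g (m, s)"
      then have s: "s \<in> lists Npos" by (simp add: H_hat.carrier_eq)
      show "\<exists>n\<in>Npos. g (m, n # s)"
      proof (cases "m = 0")
        case True
        then have "g (0, s)" using ms(2) by simp
        then obtain k where k: "k \<in> Npos" "f (k, s)" using g0[OF s] by blast
        then obtain n where "n \<in> Npos" "f (k, n # s)"
          using opn[OF H[OF pos[OF k(1)] s] k(2)] by blast
        then show ?thesis using True g0[of "n # s"] s k(1) by auto
      next
        case False
        then have "f (m, s)" using ms(2) g1[OF s] by simp
        then obtain n where "n \<in> Npos" "f (m, n # s)" using opn[OF H[OF False s]] by blast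
        then show ?thesis using False g1[of "n # s"] s by auto
      qed
    qed
    moreover have "g x = f x" if "x \<in> carrier H" for x
    proof -
      obtain m s where "x = (m, s)" "m \<in> Npos" "s \<in> lists Npos"
        using \<open>x \<in> carrier H\<close> unfolding H.carrier_eq by blast
      then show ?thesis using g1 pos by simp
    qed
    ultimately show ?thesis by (intro bexI[of _ g]) simp_all
  qed
  show "g' y" if g: "g \<in> scott_maps H_hat two" "g' \<in> scott_maps H_hat two"
    and le: "\<And>x. x \<in> carrier H \<Longrightarrow> g ((\<lambda>p\<in>carrier H. p) x) \<longrightarrow> g' ((\<lambda>p\<in>carrier H. p) x)"
    and y: "y \<in> carrier H_hat" "g y" for g g' y
  proof -
    obtain m s where ms: "y = (m, s)" by fastforce
    have s: "s \<in> lists Npos" using y ms by (simp add: H_hat.carrier_eq)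
    show ?thesis
    proof (cases "m = 0")
      case False
      then have "y \<in> carrier H" using s ms by (auto simp: H.carrier_eq Npos_def)
      then show ?thesis using le y by auto
    next
      \<comment> \<open>Here \<open>y\<close> is the supremum of the chain of all
        \<open>(0, n # s)\<close>, so one of these is in the open set \<open>g\<close>. It lies
        below \<open>(n, s)\<close>, because the deleted entry is \<open>n\<close> itself and
        \<open>n\<close> is at most the index \<open>n\<close>. That point belongs to
        \<open>H\<close>, where \<open>le\<close> applies, and is again below
        \<open>y\<close>.\<close>
      case True
      then obtain n where n: "n \<in> Npos" "g (0, n # s)"
        using g(1) y unfolding H_hat.scott_maps_two_iff ms by blast
      have mem: "(0, n # s) \<in> carrier H_hat" "(n, s) \<in> carrier H_hat" "(n, s) \<in> carrier H"
        using n s by (auto simp: H.carrier_eq H_hat.carrier_eq)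
      have "hle (0, n # s) (n, s)"
        using hleI[of s s 0 n "[n]"] by simp
      then have "g (n, s)" using g(1) n(2) mem unfolding H_hat.scott_maps_two_iff by blast
      then have "g' (n, s)" using le mem by auto
      moreover have "hle (n, s) y" using hleI[of s s n 0 "[]"] by (simp add: ms True)
      ultimately show ?thesis
        using g(2) mem y unfolding H_hat.scott_maps_two_iff by blast
    qed
  qed
qed

section \<open>The identity of \<open>H\<close> does not extend\<close>

text \<open>The carriers of \<open>H\<close> and \<open>H_hat\<close> lie in a countable type, so
  any infinite universe has room for copies of both.\<close>

lemma infinite_UNIV_countable_inj:
  assumes "infinite (UNIV :: 'u set)"
  obtains j :: "'a::countable \<Rightarrow> 'u" where "inj j"
proof -
  obtain h :: "nat \<Rightarrow> 'u" where "inj h" using infinite_countable_subset[OF assms] by blast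
  then have "inj (h \<circ> (to_nat :: 'a \<Rightarrow> nat))" by (intro inj_compose inj_to_nat)
  then show thesis using that by blast
qed

text \<open>Here \<open>j\<close> puts the test map into the universe of \<open>R2\<close>, while
  \<open>p\<close> moves the target to an arbitrary type. Taking \<open>p = id\<close> settles
  \<open>H\<close> itself; a copy of \<open>H\<close> in the test universe witnesses the strict
  inclusion.\<close>

lemma image_order_H_notin_R2:
  fixes p :: "nat \<times> nat list \<Rightarrow> 'c"
  assumes inf: "infinite (UNIV :: 'u set)" and p: "inj p"
  shows "image_order p H \<notin> R2 TYPE('u)"
proof
  let ?C = "image_order p H"
  assume R2: "?C \<in> R2 TYPE('u)"
  obtain j :: "nat \<times> nat list \<Rightarrow> 'u" where j: "inj j"
    using infinite_UNIV_countable_inj[OF inf] .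
  let ?A = "image_order j H" and ?B = "image_order j H_hat"
  let ?e = "\<lambda>x\<in>j ` carrier H. j ((\<lambda>q\<in>carrier H. q) (inv j x))"
  have "(?A, ?B, ?e) \<in> E2" by (rule E2_image_order[OF j H_inclusion_E2])
  then have iso: "dcpo_iso (fun_dcpo ?B ?C) (fun_dcpo ?A ?C) (precomp ?A ?B ?C ?e)"
    using R2 unfolding R2_def orth_def by blast
  have jB: "order_iso H_hat ?B j" and pC: "order_iso H ?C p" and iA: "order_iso ?A H (inv j)"
    using order_iso_image_order order_iso_inv_image_order j p H.partial_order H_hat.partial_order
    by blast+
  obtain g where g: "g \<in> scott_maps ?B ?C"
    "\<forall>x\<in>carrier ?A. g (?e x) = compose (carrier ?A) (restrict p (carrier H))
      (restrict (inv j) (carrier ?A)) x"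
    using precomp_iso_extension[OF iso
        scott_maps_compose[OF order_iso_scott_map[OF iA] order_iso_scott_map[OF pC]]] by blast
  have gj: "g (j q) = p q" if "q \<in> carrier H" for q
    using bspec[OF g(2), of "j q"] j that by (simp add: compose_def)
  have top: "(0, []) \<in> carrier H_hat" by (simp add: H_hat.carrier_eq)
  then have "j (0, []) \<in> carrier ?B" by simp
  moreover have "g \<in> carrier ?B \<rightarrow> carrier ?C" using g(1) by (simp add: scott_maps_def PiE_def)
  ultimately have "g (j (0, [])) \<in> carrier ?C" by (rule funcset_mem[rotated])
  \<comment> \<open>The point \<open>u\<close> is the value at the supremum of the level of the
    empty string; monotonicity puts it above every \<open>(m, [])\<close>.\<close>
  then obtain u where u: "g (j (0, [])) = p u" "u \<in> carrier H" by auto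
  have "fst u = m" if "m \<in> Npos" for m
  proof -
    have m: "(m, []) \<in> carrier H" "(m, []) \<in> carrier H_hat"
      using that by (auto simp: H.carrier_eq H_hat.carrier_eq)
    have "hle (m, []) (0, [])" using hleI[of "[]" "[]" m 0 "[]"] by simp
    then have "j (m, []) \<sqsubseteq>\<^bsub>?B\<^esub> j (0, [])"
      using order_isoD(4)[OF jB m(2) top] H_hat.le_iff[OF m(2) top] by blast
    then have "g (j (m, [])) \<sqsubseteq>\<^bsub>?C\<^esub> g (j (0, []))"
      using g(1) m(2) top unfolding scott_maps_def isotone_def carrier_image_order by blast
    then have "hle (m, []) u"
      using order_isoD(4)[OF pC m(1) u(2)] H.le_iff[OF m(1) u(2)] gj[OF m(1)] u(1) by metis
    \<comment> \<open>Nothing can be deleted from the empty string and 0 is not an index in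
      \<open>H\<close>, so a point above \<open>(m, [])\<close> has index \<open>m\<close>.\<close>
    then show ?thesis using u(2) by (auto simp: hle_def H.carrier_eq Npos_def)
  qed
  from this[of 1] this[of 2] show False by (simp add: Npos_def)
qed

theorem theorem3p9:
  assumes "infinite (UNIV :: 'u set)"
  shows "H \<in> DCPO \<and> H \<notin> R2 TYPE('u) \<and>
    R2 TYPE('u) \<subset> (DCPO :: 'u gorder set)"
proof (intro conjI)
  show "H \<in> DCPO" by (rule H.DCPO)
  have "image_order id H = H" by (simp add: image_order_def H_def)
  then show "H \<notin> R2 TYPE('u)"
    using image_order_H_notin_R2[OF assms, of id] by simp
  obtain j :: "nat \<times> nat list \<Rightarrow> 'u" where j: "inj j"
    using infinite_UNIV_countable_inj[OF assms] .
  have "image_order j H \<in> DCPO"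
    using order_iso_DCPO order_iso_image_order j H.partial_order H.DCPO by blast
  then show "R2 TYPE('u) \<subset> (DCPO :: 'u gorder set)"
    using image_order_H_notin_R2[OF assms j] by (auto simp: R2_def orth_def)
qed

end
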